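(* Let $A$ be a finite left brace and let $A_1,\ldots,A_n$ be the Sylow subgroups of the additive group of $A$. If for every $i$ we have $A_i\cdot A_i=0$ (i.e. $a\cdot b=0$ for all $a,b\in A_i$) and the additive group of $A_i$ is cyclic, then $A$ is a left brace of a finite multipermutation level.
   Context: A left brace is an abelian group $(A,+)$ with a multiplication $\cdot$ such that $a\cdot(b+c)=a\cdot b+a\cdot c$ for all $a,b,c\in A$ and such that the circle operation $a\circ b=a\cdot b+a+b$ makes $A$ into a group (with identity $0$). Put $A^{(1)}=A$ and let $A^{(n)}=A^{(n-1)}\cdot A$ be the additive subgroup generated by all $x\cdot a$ with $x\in A^{(n-1)}$, $a\in A$; $A$ has a finite multipermutation level if $A^{(n)}=0$ for some $n$. *)

theory Defs
  imports "HOL-Algebra.Elementary_Groups" "HOL-Algebra.Sylow" "HOL-Algebra.AbelCoset"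
begin

text \<open>
  A brace lives on the library's record of rings: \<open>\<oplus>\<close> and \<open>\<zero>\<close> are the additive group and
  \<open>\<otimes>\<close> is the brace multiplication.  The multiplication is not assumed to be associative or right
  distributive, and the field \<open>\<one>\<close> of the record plays no role.
\<close>

definition circle :: "('a, 'm) ring_scheme \<Rightarrow> 'a \<Rightarrow> 'a \<Rightarrow> 'a" where
  "circle A a b = a \<otimes>\<^bsub>A\<^esub> b \<oplus>\<^bsub>A\<^esub> a \<oplus>\<^bsub>A\<^esub> b"

definition circle_monoid :: "('a, 'm) ring_scheme \<Rightarrow> 'a monoid" where
  "circle_monoid A = \<lparr>carrier = carrier A, monoid.mult = circle A, one = \<zero>\<^bsub>A\<^esub>\<rparr>"

locale left_brace = abelian_group A for A (structure) +
  assumes mult_closed: "\<lbrakk>a \<in> carrier A; b \<in> carrier A\<rbrakk> \<Longrightarrow> a \<otimes> b \<in> carrier A"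
    and left_distrib:
      "\<lbrakk>a \<in> carrier A; b \<in> carrier A; c \<in> carrier A\<rbrakk> \<Longrightarrow> a \<otimes> (b \<oplus> c) = a \<otimes> b \<oplus> a \<otimes> c"
    and circle_group: "group (circle_monoid A)"

definition brace_prod :: "('a, 'm) ring_scheme \<Rightarrow> 'a set \<Rightarrow> 'a set \<Rightarrow> 'a set" where
  "brace_prod A U V = generate (add_monoid A) {x \<otimes>\<^bsub>A\<^esub> a | x a. x \<in> U \<and> a \<in> V}"

text \<open>The series is indexed from 1; the value at index 0 is a dummy.\<close>

fun right_series :: "('a, 'm) ring_scheme \<Rightarrow> nat \<Rightarrow> 'a set" where
  "right_series A 0 = carrier A"
| "right_series A (Suc 0) = carrier A"
| "right_series A (Suc (Suc n)) = brace_prod A (right_series A (Suc n)) (carrier A)"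

definition finite_multipermutation_level :: "('a, 'm) ring_scheme \<Rightarrow> bool" where
  "finite_multipermutation_level A \<longleftrightarrow> (\<exists>n\<ge>1. right_series A n = {\<zero>\<^bsub>A\<^esub>})"

text \<open>
  Meant for finite \<open>G\<close>.  A prime that does not divide the order of \<open>G\<close> has the trivial subgroup as
  its Sylow subgroup.
\<close>

definition sylow_subgroup :: "('a, 'm) monoid_scheme \<Rightarrow> nat \<Rightarrow> 'a set \<Rightarrow> bool" where
  "sylow_subgroup G p P \<longleftrightarrow>
     prime p \<and> subgroup P G \<and> card P = p ^ multiplicity p (order G)"

end

theory Submission
  imports Defs "HOL-Algebra.Multiplicative_Group"
begin

text \<open>
  Since the Sylow subgroups are cyclic, additive endomorphisms commute, in particular the maps
  \<open>\<lambda>\<^sub>a b = a \<cdot> b + b\<close>.  As \<open>\<lambda>\<close> turns the circle operation into composition, \<open>a \<cdot> b - b \<cdot> a\<close> lies in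
  the socle \<open>S = {s. s \<cdot> A = 0}\<close>, and \<open>A / S\<close> is a finite commutative radical ring, hence
  nilpotent.  For the nilpotency, if \<open>y = a \<cdot> x\<close> is nonzero in \<open>A / S\<close>, then \<open>y\<close> is not a multiple of itself,
  so the multiples of \<open>y\<close> form a proper subset of those of \<open>x\<close>.
\<close>

section \<open>Endomorphisms of a finite abelian group with cyclic Sylow subgroups\<close>

text \<open>The index \<open>m\<close> of \<open>P\<close> is prime to \<open>card P\<close>. Since
  \<open>y [^] m\<close> lies in \<open>P\<close> (the quotient has order \<open>m\<close>) and
  \<open>y [^] card P\<close> is trivial, Bezout makes \<open>y\<close> a power of
  \<open>y [^] m\<close>.\<close>

lemma (in comm_group) mem_sylow_subgroup:
  assumes fin: "finite (carrier G)" and P: "sylow_subgroup G p P"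
    and y: "y \<in> carrier G" and yP: "y [^] card P = \<one>"
  shows "y \<in> P"
proof -
  have p: "prime p" and sub: "subgroup P G" and cP: "card P = p ^ multiplicity p (order G)"
    using P by (auto simp: sylow_subgroup_def)
  interpret N: normal P G by (rule subgroup_imp_normal[OF sub])
  interpret Q: group "G Mod P" by (rule N.factorgroup_is_group)
  define m where "m = order (G Mod P)"
  have G: "order G = m * card P"
    unfolding m_def using lagrange[OF sub] by (simp add: FactGroup_def order_def)
  have "order G \<noteq> 0" using fin by (simp add: order_gt_0_iff_finite)
  have "\<not> p dvd m"
  proof
    assume "p dvd m"
    then have "p ^ Suc (multiplicity p (order G)) dvd order G"
      using G cP mult_dvd_mono[of p m "card P" "card P"] by simp
    then have "Suc (multiplicity p (order G)) \<le> multiplicity p (order G)"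
      using \<open>order G \<noteq> 0\<close> p by (intro multiplicity_geI) (auto simp: not_prime_unit)
    then show False by simp
  qed
  then have "coprime m (card P)"
    unfolding cP by (metis coprime_commute coprime_power_left_iff p prime_imp_coprime)
  then have "gcd (int m) (int (card P)) = 1" by simp
  then obtain u v :: int where uv: "u * int m + v * int (card P) = 1"
    by (metis bezout_int)
  have "(P #> y) [^]\<^bsub>G Mod P\<^esub> m = \<one>\<^bsub>G Mod P\<^esub>"
    unfolding m_def
    by (rule Q.pow_order_eq_1) (use y in \<open>auto simp: FactGroup_def RCOSETS_def\<close>)
  then have "P #> (y [^] m) = P"
    using N.FactGroup_pow[OF y] by (simp add: FactGroup_def)
  then have ym: "y [^] m \<in> P"
    using coset_join1[OF _ _ sub] y N.subset by blast
  have "y = y [^] (u * int m + v * int (card P))"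
    using y uv by simp
  also have "\<dots> = (y [^] int m) [^] u \<otimes> (y [^] int (card P)) [^] v"
    using y by (simp add: int_pow_mult int_pow_pow mult.commute)
  also have "\<dots> = (y [^] m) [^] u"
    using y yP by (simp add: int_pow_int)
  finally show ?thesis
    using subgroup_int_pow_closed[OF sub ym] by metis
qed

text \<open>A homomorphism preserves the relation \<open>x [^] card P = \<one>\<close>, which by
  \<open>mem_sylow_subgroup\<close> forces membership in \<open>P\<close>.\<close>

lemma (in comm_group) hom_image_sylow_subgroup:
  assumes fin: "finite (carrier G)" and P: "sylow_subgroup G p P"
    and f: "f \<in> hom G G" and x: "x \<in> P"
  shows "f x \<in> P"
proof (rule mem_sylow_subgroup[OF fin P])
  have sub: "subgroup P G" using P by (simp add: sylow_subgroup_def)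
  interpret S: group "G\<lparr>carrier := P\<rparr>" by (rule subgroup_imp_group[OF sub])
  interpret H: group_hom G G f by (simp add: group_hom_def group_hom_axioms_def f)
  have xG: "x \<in> carrier G" using sub x subgroup.subset by blast
  then show "f x \<in> carrier G" using f by (auto simp: hom_def)
  have "x [^]\<^bsub>G\<lparr>carrier := P\<rparr>\<^esub> card P = \<one>"
    using S.pow_order_eq_1[of x] x by (simp add: order_def)
  then have "x [^] card P = \<one>"
    by (simp only: nat_pow_consistent[symmetric])
  then show "f x [^] card P = \<one>"
    using H.hom_nat_pow[OF xG] by (metis H.hom_one)
qed

text \<open>On a cyclic Sylow subgroup both maps send a generator to a power of it, so they commute
  there. The points where they commute form a subgroup \<open>K\<close> containing every Sylow
  subgroup, hence everything.\<close>

lemma (in comm_group) hom_commute_of_cyclic_sylow: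
  assumes fin: "finite (carrier G)"
    and cyc: "\<And>p P. sylow_subgroup G p P \<Longrightarrow> cyclic_group (G\<lparr>carrier := P\<rparr>)"
    and f: "f \<in> hom G G" and h: "h \<in> hom G G" and x: "x \<in> carrier G"
  shows "f (h x) = h (f x)"
proof -
  interpret F: group_hom G G f by (simp add: group_hom_def group_hom_axioms_def f)
  interpret H: group_hom G G h by (simp add: group_hom_def group_hom_axioms_def h)
  define K where "K = {x \<in> carrier G. f (h x) = h (f x)}"
  have K: "subgroup K G"
    by (rule subgroupI) (auto simp: K_def)
  have syl: "P \<subseteq> K" if P: "sylow_subgroup G p P" for p P
  proof -
    have sub: "subgroup P G" using P by (simp add: sylow_subgroup_def)
    interpret S: group "G\<lparr>carrier := P\<rparr>" by (rule subgroup_imp_group[OF sub])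
    obtain g where g: "g \<in> P" and "P = range (\<lambda>n::int. g [^]\<^bsub>G\<lparr>carrier := P\<rparr>\<^esub> n)"
      using cyc[OF P] by (auto simp: S.cyclic_group)
    then have Pg: "P = range (\<lambda>n::int. g [^] n)"
      using int_pow_consistent[OF sub g] by simp
    have gG: "g \<in> carrier G" using sub g subgroup.subset by blast
    have "f g \<in> P" "h g \<in> P" by (simp_all add: hom_image_sylow_subgroup[OF fin P] f h g)
    then obtain i j :: int where fi: "f g = g [^] i" and hj: "h g = g [^] j"
      using Pg by auto
    have "f (h g) = h (f g)"
      by (simp add: fi hj gG F.hom_int_pow H.hom_int_pow int_pow_pow mult.commute)
    then have "g \<in> K" using gG by (simp add: K_def)
    then show ?thesis using Pg subgroup_int_pow_closed[OF K] by auto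
  qed
  have pos: "order G \<noteq> 0" using fin by (simp add: order_gt_0_iff_finite)
  have cK: "card K dvd order G"
    using lagrange[OF K] by (metis dvd_triv_right)
  \<comment> \<open>Compared prime by prime: \<open>K\<close> contains a Sylow subgroup for each
    prime, so its order has the full prime power.\<close>
  have "order G dvd card K"
  proof (rule multiplicity_le_imp_dvd)
    show "order G \<noteq> 0" by (rule pos)
    fix p :: nat assume p: "prime p"
    obtain m where m: "order G = p ^ multiplicity p (order G) * m"
      using multiplicity_dvd[of p "order G"] by (rule dvdE)
    then obtain P where P: "subgroup P G" "card P = p ^ multiplicity p (order G)"
      using sylow_thm[OF p is_group m fin] by blast
    then have "P \<subseteq> K" using syl[of p P] p by (simp add: sylow_subgroup_def)
    then have "subgroup P (G\<lparr>carrier := K\<rparr>)"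
      using P(1) K subgroup_incl by blast
    then have "card P dvd card K"
      using group.lagrange[OF subgroup_imp_group[OF K], of P]
      by (auto simp: order_def intro: dvdI[OF sym[OF trans[OF mult.commute]]])
    then show "multiplicity p (order G) \<le> multiplicity p (card K)"
      using P(2) p pos cK by (intro multiplicity_geI) (auto simp: not_prime_unit)
  qed
  then have "card K = card (carrier G)"
    using cK by (simp add: dvd_antisym order_def)
  then have "K = carrier G"
    using fin by (metis K card_subset_eq subgroup.subset)
  then show ?thesis using x by (auto simp: K_def)
qed

section \<open>The retract of a brace\<close>

context left_brace
begin

text \<open>This is \<open>circle A a b\<close> minus \<open>a\<close>; these maps form an action of
  the circle group by additive homomorphisms.\<close>

definition lam :: "'a \<Rightarrow> 'a \<Rightarrow> 'a" where
  "lam a b = a \<otimes> b \<oplus> b"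

text \<open>Two elements are related iff their difference lies in the socle.\<close>

definition sim :: "'a \<Rightarrow> 'a \<Rightarrow> bool" where
  "sim x y \<longleftrightarrow> x \<in> carrier A \<and> y \<in> carrier A \<and> (\<forall>b\<in>carrier A. x \<otimes> b = y \<otimes> b)"

lemma sim_sym: "sim x y \<Longrightarrow> sim y x"
  and sim_trans [trans]: "\<lbrakk>sim x y; sim y z\<rbrakk> \<Longrightarrow> sim x z"
  and sim_refl: "x \<in> carrier A \<Longrightarrow> sim x x"
  by (auto simp: sim_def)

section \<open>Zero laws, circle identities and the lambda action\<close>

lemma circle_closed:
  "\<lbrakk>a \<in> carrier A; b \<in> carrier A\<rbrakk> \<Longrightarrow> circle A a b \<in> carrier A"
  by (simp add: circle_def mult_closed)

lemma lam_closed: "\<lbrakk>a \<in> carrier A; b \<in> carrier A\<rbrakk> \<Longrightarrow> lam a b \<in> carrier A"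
  by (simp add: lam_def mult_closed)

lemma mult_zero: "a \<in> carrier A \<Longrightarrow> a \<otimes> \<zero> = \<zero>"
  using left_distrib[of a \<zero> \<zero>] mult_closed[of a \<zero>] by (simp add: add.l_cancel_one')

lemma mult_uminus:
  assumes "a \<in> carrier A" "b \<in> carrier A"
  shows "a \<otimes> (\<ominus> b) = \<ominus> (a \<otimes> b)"
  using left_distrib[of a b "\<ominus> b"] assms
  by (metis add.inv_closed add.inv_equality add.m_comm mult_closed mult_zero r_neg)

lemma circle_assoc:
  assumes "a \<in> carrier A" "b \<in> carrier A" "c \<in> carrier A"
  shows "circle A (circle A a b) c = circle A a (circle A b c)"
  using monoid.m_assoc[OF group.is_monoid[OF circle_group], of a b c] assms
  by (simp add: circle_monoid_def)

lemma circle_zero_left: "a \<in> carrier A \<Longrightarrow> circle A \<zero> a = a"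
  and circle_zero_right: "a \<in> carrier A \<Longrightarrow> circle A a \<zero> = a"
  using monoid.l_one[OF group.is_monoid[OF circle_group], of a]
    monoid.r_one[OF group.is_monoid[OF circle_group], of a]
  by (simp_all add: circle_monoid_def)

lemma circle_inverse:
  assumes "a \<in> carrier A"
  obtains b where "b \<in> carrier A" "circle A b a = \<zero>" "circle A a b = \<zero>"
proof -
  interpret C: group "circle_monoid A" by (rule circle_group)
  show thesis
    using that[of "inv\<^bsub>circle_monoid A\<^esub> a"] C.inv_closed[of a] C.l_inv[of a] C.r_inv[of a] assms
    by (simp add: circle_monoid_def)
qed

lemma zero_mult: "a \<in> carrier A \<Longrightarrow> \<zero> \<otimes> a = \<zero>"
  using circle_zero_left[of a] mult_closed[of \<zero> a]
  by (simp add: circle_def add.r_cancel_one)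

text \<open>A substitute for right distributivity: expand both sides of \<open>circle_assoc\<close>
  and cancel the common summand
  \<open>a \<otimes> b \<oplus> a \<oplus> b \<oplus> c\<close>.\<close>

lemma circle_mult:
  assumes a: "a \<in> carrier A" and b: "b \<in> carrier A" and c: "c \<in> carrier A"
  shows "circle A a b \<otimes> c = a \<otimes> (b \<otimes> c) \<oplus> (a \<otimes> c \<oplus> b \<otimes> c)"
proof -
  note cl = mult_closed[OF a b] mult_closed[OF b c] mult_closed[OF a c]
    mult_closed[OF a mult_closed[OF b c]] mult_closed[OF circle_closed[OF a b] c]
  have "(a \<otimes> (b \<otimes> c) \<oplus> (a \<otimes> c \<oplus> b \<otimes> c)) \<oplus> (a \<otimes> b \<oplus> a \<oplus> b \<oplus> c) = circle A a (circle A b c)"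
    using a b c cl by (simp add: circle_def left_distrib a_ac)
  also have "\<dots> = circle A a b \<otimes> c \<oplus> (a \<otimes> b \<oplus> a \<oplus> b \<oplus> c)"
    using circle_assoc[OF a b c] a b c cl by (simp add: circle_def a_ac)
  finally show ?thesis
    using a b c cl by simp
qed

lemma lam_circle:
  assumes a: "a \<in> carrier A" and b: "b \<in> carrier A" and c: "c \<in> carrier A"
  shows "lam (circle A a b) c = lam a (lam b c)"
  using assms by (simp add: lam_def circle_mult left_distrib mult_closed a_ac)

lemma lam_zero: "b \<in> carrier A \<Longrightarrow> lam \<zero> b = b"
  by (simp add: lam_def zero_mult)

lemma lam_hom: "a \<in> carrier A \<Longrightarrow> lam a \<in> hom (add_monoid A) (add_monoid A)"
  by (auto simp: hom_def lam_def mult_closed left_distrib a_ac)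

section \<open>Compatibility of the socle relation with addition\<close>

lemma sim_iff_lam:
  "sim x y \<longleftrightarrow> x \<in> carrier A \<and> y \<in> carrier A \<and> (\<forall>b\<in>carrier A. lam x b = lam y b)"
  by (auto simp: sim_def lam_def mult_closed)

text \<open>For \<open>s\<close> in the socle, \<open>s \<oplus> y\<close> equals
  \<open>circle A s y\<close>, and \<open>s\<close> acts trivially under \<open>lam\<close>.\<close>

lemma sim_add_socle:
  assumes s: "sim s \<zero>" and y: "y \<in> carrier A"
  shows "sim (s \<oplus> y) y"
proof -
  have sA: "s \<in> carrier A" using s by (simp add: sim_def)
  have "circle A s y = s \<oplus> y"
    using s y zero_mult by (simp add: circle_def sim_def)
  then have "lam (s \<oplus> y) b = lam y b" if b: "b \<in> carrier A" for b
    using lam_circle[OF sA y b] s lam_zero lam_closed[OF y b] b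
    by (simp add: sim_iff_lam)
  then show ?thesis using sA y by (simp add: sim_iff_lam)
qed

text \<open>Elements with the same lambda map have a circle quotient \<open>s\<close> in the kernel
  of the action, which is the socle. There circle and sum agree, so \<open>s\<close> is also the
  additive difference.\<close>

lemma sim_minus:
  assumes xy: "sim x y"
  shows "sim (x \<ominus> y) \<zero>"
proof -
  have x: "x \<in> carrier A" and y: "y \<in> carrier A" using xy by (auto simp: sim_def)
  obtain z where z: "z \<in> carrier A" "circle A z y = \<zero>" "circle A y z = \<zero>"
    using circle_inverse[OF y] .
  define s where "s = circle A x z"
  have sA: "s \<in> carrier A" using x z by (simp add: s_def circle_closed)
  have "lam s b = lam \<zero> b" if b: "b \<in> carrier A" for b
    using xy lam_circle[OF x z(1) b] lam_circle[OF y z(1) b] lam_closed[OF z(1) b] z(3)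
    by (simp add: s_def sim_iff_lam)
  then have s: "sim s \<zero>" using sA by (simp add: sim_iff_lam)
  have "x = circle A s y"
    using circle_assoc[OF x z(1) y] z(2) circle_zero_right[OF x] by (simp add: s_def)
  also have "\<dots> = s \<oplus> y"
    using s y zero_mult by (simp add: circle_def sim_def)
  finally have "x \<ominus> y = s"
    using sA y by (simp add: minus_eq a_assoc r_neg)
  then show ?thesis using s by simp
qed

lemma add_minus_cancel:
  assumes "x \<in> carrier A" "y \<in> carrier A"
  shows "(x \<ominus> y) \<oplus> y = x"
  using assms by (simp add: minus_eq a_assoc l_neg)

lemma sim_add_right:
  assumes xy: "sim x y" and z: "z \<in> carrier A"
  shows "sim (x \<oplus> z) (y \<oplus> z)"
proof -
  have x: "x \<in> carrier A" and y: "y \<in> carrier A" using xy by (auto simp: sim_def)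
  have "x \<oplus> z = (x \<ominus> y) \<oplus> (y \<oplus> z)"
    using add_minus_cancel[OF x y] x y z by (metis a_assoc minus_closed)
  then show ?thesis
    using sim_add_socle[OF sim_minus[OF xy], of "y \<oplus> z"] y z by simp
qed

lemma sim_add:
  assumes xy: "sim x y" and zw: "sim z w"
  shows "sim (x \<oplus> z) (y \<oplus> w)"
proof -
  have cl: "x \<in> carrier A" "y \<in> carrier A" "z \<in> carrier A" "w \<in> carrier A"
    using assms by (auto simp: sim_def)
  have "sim (x \<oplus> z) (y \<oplus> z)" by (rule sim_add_right[OF xy cl(3)])
  also have "sim (y \<oplus> z) (y \<oplus> w)"
    using sim_add_right[OF zw cl(2)] cl by (simp add: a_comm)
  finally show ?thesis .
qed

lemma sim_add_cancel:
  assumes "sim (x \<oplus> z) (y \<oplus> z)" "x \<in> carrier A" "y \<in> carrier A" "z \<in> carrier A"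
  shows "sim x y"
  using sim_add_right[OF assms(1), of "\<ominus> z"] assms by (simp add: a_assoc r_neg)

end

section \<open>Braces with commuting lambda maps\<close>

locale left_brace_lam_commute = left_brace +
  assumes lam_commute:
    "\<lbrakk>a \<in> carrier A; b \<in> carrier A; c \<in> carrier A\<rbrakk> \<Longrightarrow> lam a (lam b c) = lam b (lam a c)"
begin

text \<open>The two circle products have the same lambda map, and they differ from the two products
  by the same summand \<open>a \<oplus> b\<close>.\<close>

lemma sim_mult_commute:
  assumes a: "a \<in> carrier A" and b: "b \<in> carrier A"
  shows "sim (a \<otimes> b) (b \<otimes> a)"
proof -
  have "sim (circle A a b) (circle A b a)"
    using assms by (simp add: sim_iff_lam circle_closed lam_circle lam_commute)
  then show ?thesis
    using sim_add_cancel[of "a \<otimes> b" "a \<oplus> b" "b \<otimes> a"] a b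
    by (simp add: circle_def mult_closed a_ac)
qed

text \<open>By definition \<open>sim\<close> controls left factors; commutativity modulo the socle
  transfers this to right factors.\<close>

lemma sim_mult_left:
  assumes xy: "sim x y" and a: "a \<in> carrier A"
  shows "sim (a \<otimes> x) (a \<otimes> y)"
proof -
  have x: "x \<in> carrier A" and y: "y \<in> carrier A" using xy by (auto simp: sim_def)
  show ?thesis
    using sim_mult_commute[OF a x] sim_mult_commute[OF y a] xy a
    by (metis sim_def sim_trans)
qed

text \<open>Multiplying \<open>x\<close> by \<open>circle A c a\<close> is expanded by
  \<open>circle_mult\<close> on one side and by left distributivity on the other. Commutativity
  modulo the socle matches the two, and the summands with two factors cancel.\<close>

lemma sim_mult_assoc:
  assumes c: "c \<in> carrier A" and a: "a \<in> carrier A" and x: "x \<in> carrier A"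
  shows "sim (c \<otimes> (a \<otimes> x)) ((c \<otimes> a) \<otimes> x)"
proof (rule sim_add_cancel[of _ "c \<otimes> x \<oplus> a \<otimes> x"])
  have ca: "c \<otimes> a \<in> carrier A" using c a by (rule mult_closed)
  have "sim (c \<otimes> (a \<otimes> x) \<oplus> (c \<otimes> x \<oplus> a \<otimes> x)) (x \<otimes> circle A c a)"
    using sim_mult_commute[OF circle_closed[OF c a] x] by (simp add: circle_mult c a x)
  also have "x \<otimes> circle A c a = x \<otimes> (c \<otimes> a) \<oplus> (x \<otimes> c \<oplus> x \<otimes> a)"
    using c a x ca by (simp add: circle_def left_distrib mult_closed a_ac)
  also have "sim \<dots> ((c \<otimes> a) \<otimes> x \<oplus> (c \<otimes> x \<oplus> a \<otimes> x))"
    by (intro sim_add sim_mult_commute c a x ca)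
  finally show "sim (c \<otimes> (a \<otimes> x) \<oplus> (c \<otimes> x \<oplus> a \<otimes> x)) ((c \<otimes> a) \<otimes> x \<oplus> (c \<otimes> x \<oplus> a \<otimes> x))" .
qed (use assms in \<open>simp_all add: mult_closed\<close>)

text \<open>The circle inverse of \<open>\<ominus> c\<close> plays the role of \<open>(1 - c)\<^sup>-\<^sup>1\<close>.\<close>

lemma sim_mult_self_imp_zero:
  assumes y: "y \<in> carrier A" and c: "c \<in> carrier A" and yc: "sim y (y \<otimes> c)"
  shows "sim y \<zero>"
proof -
  have nc: "\<ominus> c \<in> carrier A" and ycA: "y \<otimes> c \<in> carrier A"
    using c y by (simp_all add: mult_closed)
  obtain d where d: "d \<in> carrier A" "circle A d (\<ominus> c) = \<zero>"
    using circle_inverse[OF nc] .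
  \<comment> \<open>Modulo the socle \<open>u\<close> is \<open>y\<close> minus
    \<open>y \<otimes> c\<close>, hence zero; applying \<open>lam d\<close> undoes
    \<open>lam (\<ominus> c)\<close> and recovers \<open>y\<close>.\<close>
  define u where "u = lam (\<ominus> c) y"
  have "sim u (y \<otimes> (\<ominus> c) \<oplus> y \<otimes> c)"
    unfolding u_def lam_def by (intro sim_add sim_mult_commute nc y yc)
  then have u: "sim u \<zero>" using ycA by (simp add: mult_uminus y c l_neg)
  have "y = lam d u"
    using lam_circle[OF d(1) nc y] d(2) lam_zero[OF y] by (simp add: u_def)
  also have "sim \<dots> (d \<otimes> \<zero> \<oplus> \<zero>)"
    unfolding lam_def by (intro sim_add sim_mult_left u d)
  finally show ?thesis using d by (simp add: mult_zero)
qed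

section \<open>Nilpotency modulo the socle\<close>

definition principal :: "'a \<Rightarrow> 'a set" where
  "principal x = {z \<in> carrier A. \<exists>c\<in>carrier A. sim z (x \<otimes> c)}"

text \<open>Inclusion is associativity and commutativity modulo the socle. As
  \<open>principal\<close> does not adjoin its generator, \<open>a \<otimes> x\<close> itself
  separates the two sets.\<close>

lemma principal_mult_psubset:
  assumes a: "a \<in> carrier A" and x: "x \<in> carrier A" and n: "\<not> sim (a \<otimes> x) \<zero>"
  shows "principal (a \<otimes> x) \<subset> principal x"
proof
  have ax: "a \<otimes> x \<in> carrier A" using a x by (rule mult_closed)
  show "principal (a \<otimes> x) \<subseteq> principal x"
  proof
    fix z assume "z \<in> principal (a \<otimes> x)"
    then obtain c where z: "z \<in> carrier A" and c: "c \<in> carrier A" and "sim z ((a \<otimes> x) \<otimes> c)"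
      by (auto simp: principal_def)
    note this(3)
    also have "sim ((a \<otimes> x) \<otimes> c) (c \<otimes> (a \<otimes> x))" by (rule sim_mult_commute[OF ax c])
    also have "sim \<dots> ((c \<otimes> a) \<otimes> x)" by (rule sim_mult_assoc[OF c a x])
    also have "sim \<dots> (x \<otimes> (c \<otimes> a))" by (rule sim_mult_commute[OF mult_closed[OF c a] x])
    finally show "z \<in> principal x" using z mult_closed[OF c a] by (auto simp: principal_def)
  qed
  have "a \<otimes> x \<in> principal x"
    using sim_mult_commute[OF a x] a ax by (auto simp: principal_def)
  moreover have "a \<otimes> x \<notin> principal (a \<otimes> x)"
    using sim_mult_self_imp_zero[OF ax] n by (auto simp: principal_def)
  ultimately show "principal (a \<otimes> x) \<noteq> principal x" by blast
qed

text \<open>Elements sent into the socle by any \<open>k\<close> successive left multiplications.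
  Placing \<open>x\<close> on the right lets left distributivity make each term a subgroup.\<close>

primrec socle_series :: "nat \<Rightarrow> 'a set" where
  "socle_series 0 = {x. sim x \<zero>}"
| "socle_series (Suc k) = {x \<in> carrier A. \<forall>c\<in>carrier A. c \<otimes> x \<in> socle_series k}"

lemma socle_le_series: "sim x \<zero> \<Longrightarrow> x \<in> socle_series k"
proof (induction k arbitrary: x)
  case (Suc k)
  have "sim (c \<otimes> x) \<zero>" if "c \<in> carrier A" for c
    using sim_mult_left[OF Suc.prems that] that by (simp add: mult_zero)
  then show ?case using Suc by (auto simp: sim_def)
qed simp

lemma socle_series_subset: "socle_series k \<subseteq> carrier A"
  by (cases k) (auto simp: sim_def)

lemma subgroup_socle_series: "subgroup (socle_series k) (add_monoid A)"
proof (induction k)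
  case 0
  show ?case
  proof (rule add.subgroupI)
    show "socle_series 0 \<subseteq> carrier A" by (rule socle_series_subset)
    show "socle_series 0 \<noteq> {}" using sim_refl[OF zero_closed] by auto
    fix x assume "x \<in> socle_series 0"
    then have x: "sim x \<zero>" by simp
    then have "x \<in> carrier A" by (simp add: sim_def)
    then show "\<ominus> x \<in> socle_series 0"
      using sim_minus[OF sim_sym[OF x]] by (simp add: minus_eq)
    fix y assume "y \<in> socle_series 0"
    then show "x \<oplus> y \<in> socle_series 0" using sim_add[OF x, of y \<zero>] by simp
  qed
next
  case (Suc k)
  interpret K: subgroup "socle_series k" "add_monoid A" by (rule Suc)
  show ?case
  proof (rule add.subgroupI)
    show "socle_series (Suc k) \<subseteq> carrier A" by (rule socle_series_subset)
    show "socle_series (Suc k) \<noteq> {}"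
      using socle_le_series[OF sim_refl[OF zero_closed]] by blast
  next
    fix x assume x: "x \<in> socle_series (Suc k)"
    then show "\<ominus> x \<in> socle_series (Suc k)"
      using K.m_inv_closed by (auto simp: mult_uminus a_inv_def[symmetric])
    fix y assume "y \<in> socle_series (Suc k)"
    then show "x \<oplus> y \<in> socle_series (Suc k)"
      using K.m_closed x by (auto simp: left_distrib)
  qed
qed

text \<open>The difference of \<open>z\<close> and \<open>w\<close> is in the socle, which every
  term contains. This permits swapping factors inside a term.\<close>

lemma socle_series_sim:
  assumes zw: "sim z w" and w: "w \<in> socle_series k"
  shows "z \<in> socle_series k"
proof -
  interpret K: subgroup "socle_series k" "add_monoid A" by (rule subgroup_socle_series)
  have "(z \<ominus> w) \<oplus> w \<in> socle_series k"
    using K.m_closed[OF socle_le_series[OF sim_minus[OF zw]] w] by simp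
  then show ?thesis using zw add_minus_cancel by (simp add: sim_def)
qed

text \<open>Each left multiplication either lands in the socle or strictly shrinks the finite set
  \<open>principal x\<close>.\<close>

lemma principal_card_socle_series:
  assumes fin: "finite (carrier A)"
  shows "\<lbrakk>x \<in> carrier A; card (principal x) \<le> k\<rbrakk> \<Longrightarrow> x \<in> socle_series k"
proof (induction k arbitrary: x)
  have finp: "finite (principal x)" for x
    using fin by (auto simp: principal_def)
  case 0
  \<comment> \<open>The base case is vacuous, because \<open>principal x\<close> is never
    empty.\<close>
  have "x \<otimes> \<zero> \<in> principal x"
    using 0(1) sim_refl[of "x \<otimes> \<zero>"] zero_closed
    unfolding principal_def by (blast intro: mult_closed)
  then show ?case using 0 finp by auto
next
  have finp: "finite (principal x)" for x
    using fin by (auto simp: principal_def)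
  case (Suc k)
  have "c \<otimes> x \<in> socle_series k" if c: "c \<in> carrier A" for c
  proof (cases "sim (c \<otimes> x) \<zero>")
    case True
    then show ?thesis by (rule socle_le_series)
  next
    case False
    have "card (principal (c \<otimes> x)) < card (principal x)"
      by (rule psubset_card_mono[OF finp principal_mult_psubset[OF c Suc.prems(1) False]])
    then show ?thesis using Suc c by (simp add: mult_closed)
  qed
  then show ?case using Suc.prems by simp
qed

lemma finite_imp_multipermutation:
  assumes fin: "finite (carrier A)"
  shows "finite_multipermutation_level A"
proof -
  define N where "N = card (carrier A)"
  have top: "carrier A \<subseteq> socle_series N"
  proof
    fix x assume x: "x \<in> carrier A"
    have "card (principal x) \<le> N"
      unfolding N_def by (rule card_mono[OF fin]) (auto simp: principal_def)
    then show "x \<in> socle_series N"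
      using principal_card_socle_series[OF fin x] by blast
  qed
  \<comment> \<open>The right series starts at index 1, so its term \<open>Suc n\<close> is the
    result of \<open>n\<close> multiplications, each lowering the socle index by one.\<close>
  have ser: "right_series A (Suc n) \<subseteq> socle_series (N - n)" if "n \<le> N" for n
    using that
  proof (induction n)
    case 0
    then show ?case using top by simp
  next
    case (Suc n)
    define k where "k = N - Suc n"
    have k: "N - n = Suc k" using Suc.prems by (simp add: k_def)
    have "x \<otimes> a \<in> socle_series k" if "x \<in> right_series A (Suc n)" and a: "a \<in> carrier A" for x a
    proof -
      have x: "x \<in> socle_series (Suc k)" using Suc that k by auto
      \<comment> \<open>The right series multiplies on the right, \<open>socle_series\<close> on the
        left; commutativity modulo the socle bridges the two.\<close>
      then show ?thesis
        using socle_series_sim[OF sim_mult_commute, of x a k] a by auto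
    qed
    then have "generate (add_monoid A) {x \<otimes> a | x a. x \<in> right_series A (Suc n) \<and> a \<in> carrier A}
        \<subseteq> socle_series k"
      by (intro add.generate_subgroup_incl subgroup_socle_series) auto
    then show ?case by (simp add: brace_prod_def k_def)
  qed
  have soc: "right_series A (Suc N) \<subseteq> {x. sim x \<zero>}"
    using ser[of N] by simp
  \<comment> \<open>One further product turns vanishing modulo the socle into vanishing, since socle
    elements annihilate \<open>A\<close> from the left.\<close>
  have "generate (add_monoid A) {x \<otimes> a | x a. x \<in> right_series A (Suc N) \<and> a \<in> carrier A}
      \<subseteq> {\<zero>}"
  proof (intro add.generate_subgroup_incl)
    show "{x \<otimes> a | x a. x \<in> right_series A (Suc N) \<and> a \<in> carrier A} \<subseteq> {\<zero>}"
      using soc by (auto simp: sim_def zero_mult)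
    show "subgroup {\<zero>} (add_monoid A)" using add.triv_subgroup by simp
  qed
  moreover have "\<zero> \<in> right_series A (Suc (Suc N))"
    using generate.one[of "add_monoid A"] by (simp add: brace_prod_def)
  ultimately have "right_series A (Suc (Suc N)) = {\<zero>}"
    by (auto simp: brace_prod_def)
  then show ?thesis
    unfolding finite_multipermutation_level_def by (intro exI[of _ "Suc (Suc N)"]) simp
qed

end

theorem corollary12:
  fixes A :: "('a, 'm) ring_scheme"
  assumes "left_brace A"
    and "finite (carrier A)"
    and "\<And>p P a b. \<lbrakk>sylow_subgroup (add_monoid A) p P; a \<in> P; b \<in> P\<rbrakk> \<Longrightarrow> a \<otimes>\<^bsub>A\<^esub> b = \<zero>\<^bsub>A\<^esub>"
    and "\<And>p P. sylow_subgroup (add_monoid A) p P \<Longrightarrow> cyclic_group ((add_monoid A)\<lparr>carrier := P\<rparr>)"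
  shows "finite_multipermutation_level A"
proof -
  interpret left_brace A by fact
  have "left_brace_lam_commute A"
  proof
    fix a b c assume "a \<in> carrier A" "b \<in> carrier A" "c \<in> carrier A"
    then show "lam a (lam b c) = lam b (lam a c)"
      using comm_group.hom_commute_of_cyclic_sylow[OF a_comm_group _ assms(4) lam_hom lam_hom] assms(2) by simp
  qed
  then show ?thesis
    using assms(2) by (rule left_brace_lam_commute.finite_imp_multipermutation)
qed

end
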